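(* Let $A$ be a (possibly infinite) alphabet and let $<$ be the generalized lexicographic order induced by a sequence $(<_n)_{n\in\mathbb{N}}$ of total orders on $A$. Then every infinite word $w$ over $A$ has a unique nonincreasing factorization into (finite and infinite) generalized Lyndon words; that is, there is exactly one sequence $(\ell_i)_{1\le i\le n}$ (if $n\in\mathbb{N}$), or $(\ell_i)_{i\ge 1}$ (if $n=\infty$), of generalized Lyndon words such that $w=\prod_{i=1}^n \ell_i$ and $\ell_i^\omega\ge \ell_{i+1}^\omega$ for all integers $i\in[1,n)$.
   Context: $\mathbb{N}=\{1,2,3,\dots\}$. Words are finite or infinite (to the right) sequences of letters of $A$. For each $n\in\mathbb{N}$ let $<_n$ be a total order on $A$. The generalized lexicographic order $<$ induced by $(<_n)_{n\in\mathbb{N}}$ on finite and infinite words is: $x<y$ if and only if $x$ is a proper prefix of $y$, or $x=pas$ and $y=pbs'$ for words $p,s,s'$ ($p$ finite) and letters $a,b$ with $a<_{|p|+1}b$. For a nonempty finite word $u$, $u^\omega$ is the infinite word $uuu\cdots$; if $u$ is infinite, $u^\omega=u$ by convention. A nonempty finite word $w$ is generalized Lyndon if $uv<vu$ for every factorization $w=uv$ with $u,v$ both nonempty. An infinite word $w$ is generalized Lyndon if $w<v$ for every factorization $w=uv$ with $u$ a nonempty finite word. A nonincreasing generalized Lyndon factorization of a word $w$ is a product $w=\prod_{i=1}^n\ell_i$ with $n\in\mathbb{N}\cup\{\infty\}$, each $\ell_i$ generalized Lyndon, and $\ell_i^\omega\ge\ell_{i+1}^\omega$ for all $i\in[1,n)$;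 only the last factor of a factorization with finitely many terms may be an infinite word. *)

theory Defs
  imports "HOL-Library.Stream"
begin

text \<open>
  Finite or right-infinite words over the letters of type \<open>'a\<close>. The same type, over words as
  letters, serves for finite or infinite sequences of factors.
\<close>

datatype 'a word = Fin "'a list" | Inf "'a stream"

primrec conc :: "'a list \<Rightarrow> 'a word \<Rightarrow> 'a word" (infixr \<open>\<cdot>\<close> 65) where
  "u \<cdot> Fin v = Fin (u @ v)"
| "u \<cdot> Inf s = Inf (u @- s)"

definition proper_prefix :: "'a word \<Rightarrow> 'a word \<Rightarrow> bool" where
  "proper_prefix x y \<longleftrightarrow> (\<exists>u v. x = Fin u \<and> v \<noteq> Fin [] \<and> y = u \<cdot> v)"

text \<open>
  \<open>r n\<close> is the strict order on letters used at position \<open>n\<close>, positions being counted from 1;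
  \<open>r 0\<close> is never used.
\<close>

definition gless :: "(nat \<Rightarrow> 'a rel) \<Rightarrow> 'a word \<Rightarrow> 'a word \<Rightarrow> bool" where
  "gless r x y \<longleftrightarrow>
     proper_prefix x y \<or>
     (\<exists>p a b s s'. x = p \<cdot> [a] \<cdot> s \<and> y = p \<cdot> [b] \<cdot> s' \<and> (a, b) \<in> r (length p + 1))"

definition gle :: "(nat \<Rightarrow> 'a rel) \<Rightarrow> 'a word \<Rightarrow> 'a word \<Rightarrow> bool" where
  "gle r x y \<longleftrightarrow> gless r x y \<or> x = y"

text \<open>Only meaningful on nonempty words, since \<open>cycle []\<close> is an unspecified stream.\<close>

primrec omega_power :: "'a word \<Rightarrow> 'a word" where
  "omega_power (Fin u) = Inf (cycle u)"
| "omega_power (Inf s) = Inf s"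

primrec generalized_Lyndon :: "(nat \<Rightarrow> 'a rel) \<Rightarrow> 'a word \<Rightarrow> bool" where
  "generalized_Lyndon r (Fin w) \<longleftrightarrow>
     w \<noteq> [] \<and>
     (\<forall>u v. w = u @ v \<longrightarrow> u \<noteq> [] \<longrightarrow> v \<noteq> [] \<longrightarrow> gless r (Fin (u @ v)) (Fin (v @ u)))"
| "generalized_Lyndon r (Inf w) \<longleftrightarrow>
     (\<forall>u v. w = u @- v \<longrightarrow> u \<noteq> [] \<longrightarrow> gless r (Inf w) (Inf v))"

text \<open>
  \<open>is_product ls w\<close>: the sequence \<open>ls\<close> is nonempty, all its terms are finite words except
  possibly the last term of a finite sequence, and their concatenation is \<open>w\<close>. In an infinite
  product the factors are required to be nonempty, because \<open>flat\<close> is the concatenation only then.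
\<close>

primrec is_product :: "'a word word \<Rightarrow> 'a word \<Rightarrow> bool" where
  "is_product (Fin ls) w \<longleftrightarrow> (\<exists>us l. ls = map Fin us @ [l] \<and> w = concat us \<cdot> l)"
| "is_product (Inf ls) w \<longleftrightarrow> (\<exists>us. ls = smap Fin us \<and> [] \<notin> sset us \<and> w = Inf (flat us))"

primrec factors :: "'a word \<Rightarrow> 'a set" where
  "factors (Fin ls) = set ls"
| "factors (Inf ls) = sset ls"

primrec nonincreasing :: "(nat \<Rightarrow> 'a rel) \<Rightarrow> 'a word word \<Rightarrow> bool" where
  "nonincreasing r (Fin ls) \<longleftrightarrow>
     (\<forall>i. Suc i < length ls \<longrightarrow> gle r (omega_power (ls ! Suc i)) (omega_power (ls ! i)))"
| "nonincreasing r (Inf ls) \<longleftrightarrow>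
     (\<forall>i. gle r (omega_power (ls !! Suc i)) (omega_power (ls !! i)))"

definition nonincreasing_Lyndon_factorization ::
    "(nat \<Rightarrow> 'a rel) \<Rightarrow> 'a word word \<Rightarrow> 'a word \<Rightarrow> bool" where
  "nonincreasing_Lyndon_factorization r ls w \<longleftrightarrow>
     is_product ls w \<and> (\<forall>l \<in> factors ls. generalized_Lyndon r l) \<and> nonincreasing r ls"

end

theory Submission
  imports Defs
begin

text \<open>
  Since \<open>u @- y\<close> and \<open>cycle u\<close> compare in the same way with \<open>y\<close>, the word \<open>u @ v\<close> precedes
  \<open>v @ u\<close> iff \<open>cycle (u @ v) < cycle v\<close> iff \<open>cycle u < cycle v\<close>. So being Lyndon means
  having a smaller omega power than every proper suffix.

  Uniqueness. A factorization is determined by its set of cuts. By the above, the factor that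
  ends at a cut \<open>b\<close> is the shortest of the words ending at \<open>b\<close> with minimal omega power, so two
  factorizations coincide before any common cut. Suppose that they differ after their last common
  cut. If a cut \<open>d\<close> belongs to only one of them and \<open>y\<close> is the word between the preceding cut of
  either one and \<open>d\<close>, then \<open>cycle y\<close> lies between the omega powers of the factors in which the
  two factorizations continue at \<open>d\<close>, and one of these two inequalities is strict. Inductively,
  the two omega powers at each cut agree on ever longer prefixes, so they are equal, a
  contradiction.

  Existence. Every finite word has a nonincreasing Lyndon factorization: split off the shortest
  suffix with minimal omega power and recurse. Apply this to all prefixes of \<open>w\<close> and use
  compactness. Either an infinite factorization arises, or \<open>w = u\<^sub>1 \<cdots> u\<^sub>k W\<close> where infinitely
  many prefixes of \<open>W\<close> can be the next factor. Then \<open>W\<close> is a minimum among its suffixes; either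
  it is an infinite Lyndon word, or it is \<open>cycle u\<close> with \<open>u\<close> Lyndon, its shortest period.
\<close>

section \<open>Common prefixes of streams and periodic streams\<close>

lemma snth_ext: "(\<And>n. x !! n = y !! n) \<Longrightarrow> x = y"
  using smap_alt[of id x y] by (simp add: stream.map_id)

lemma stake_eq_mono: "stake n x = stake n y \<Longrightarrow> m \<le> n \<Longrightarrow> stake m x = stake m y"
  by (metis min_absorb1 take_stake)

lemma stake_eq_snth: "stake n x = stake n y \<Longrightarrow> i < n \<Longrightarrow> x !! i = y !! i"
  by (metis stake_nth)

lemma stake_Suc_snth: "stake (Suc n) x = stake n x @ [x !! n]"
  using stake_add[of n x 1] by simp

lemma stake_Suc_eq_iff: "stake (Suc n) x = stake (Suc n) y \<longleftrightarrow> stake n x = stake n y \<and> x !! n = y !! n"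
  unfolding stake_Suc_snth by simp

lemma stake_eq_all: "(\<And>n. stake n x = stake n y) \<Longrightarrow> x = y"
  by (metis snth_ext stake_Suc_eq_iff)

lemma stake_shift_eq_iff: "stake (length u + n) (u @- x) = stake (length u + n) (u @- y) \<longleftrightarrow> stake n x = stake n y"
  by (simp add: stake_shift)

lemma first_disagreement:
  assumes "x \<noteq> y"
  obtains n where "stake n x = stake n y" "x !! n \<noteq> y !! n"
proof -
  have "\<exists>n. x !! n \<noteq> y !! n"
    using assms snth_ext by blast
  then obtain n where n: "x !! n \<noteq> y !! n" "\<forall>i<n. x !! i = y !! i"
    using exists_least_iff[of "\<lambda>n. x !! n \<noteq> y !! n"] by blast
  have "stake n x = stake n y"
    using n(2) by (intro nth_equalityI) auto
  then show thesis using that n by blast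
qed

text \<open>Agreement on \<open>n\<close> letters improves to agreement on
  \<open>length u + n > n\<close> letters when \<open>u\<close> is prepended, so it spreads over the
  whole streams.\<close>

lemma shift_fixpoint_unique:
  assumes "u \<noteq> []" "u @- x = x" "u @- y = y"
  shows "x = y"
proof (rule stake_eq_all)
  fix n
  show "stake n x = stake n y"
  proof (induction n)
    case (Suc n)
    then have "stake (length u + n) (u @- x) = stake (length u + n) (u @- y)"
      by (simp add: stake_shift)
    moreover have "Suc n \<le> length u + n"
      using assms(1) by (cases u) auto
    ultimately show ?case
      using assms by (metis stake_eq_mono)
  qed simp
qed

lemma cycle_unfold: "u \<noteq> [] \<Longrightarrow> u @- cycle u = cycle u"
  by (metis cycle_decomp)

lemma cycle_unique: "u \<noteq> [] \<Longrightarrow> u @- x = x \<Longrightarrow> cycle u = x"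
  using shift_fixpoint_unique cycle_unfold by blast

lemma cycle_append_unfold: "u \<noteq> [] \<Longrightarrow> u @- v @- cycle (u @ v) = cycle (u @ v)"
  using cycle_unfold[of "u @ v"] by simp

text \<open>Commutation makes \<open>u @- cycle v\<close> a fixed point of prepending
  \<open>v\<close>, hence equal to \<open>cycle v\<close>; so \<open>cycle v\<close> is also the
  fixed point of prepending \<open>u\<close>.\<close>

lemma cycle_eq_of_commute:
  assumes "u \<noteq> []" "v \<noteq> []" "u @ v = v @ u"
  shows "cycle u = cycle v"
proof -
  have "v @- u @- cycle v = u @- cycle v"
    using assms by (metis shift_append cycle_unfold)
  then have "u @- cycle v = cycle v"
    using assms cycle_unique by metis
  then show ?thesis
    using assms cycle_unique by metis
qed

text \<open>
  By the Fine--Wilf theorem, distinct \<open>cycle u\<close> and \<open>cycle v\<close> cannot agree on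
  \<open>length u + length v\<close> letters; before that bound, \<open>u @- v @- x\<close> follows \<open>cycle u\<close> one letter
  further than \<open>cycle v\<close> does.
\<close>

lemma stake_Suc_cycle:
  assumes "u \<noteq> []" "v \<noteq> []" "cycle u \<noteq> cycle v" and q: "stake q (cycle u) = stake q (cycle v)"
  shows "stake (Suc q) (cycle u) = stake (Suc q) (u @- v @- x)"
proof -
  \<comment> \<open>Otherwise the common prefix of length \<open>length u + length v\<close> would
    equal both \<open>u @ v\<close> and \<open>v @ u\<close>.\<close>
  have bound: "q < length u + length v"
  proof (rule ccontr)
    assume "\<not> q < length u + length v"
    then have *: "stake n (cycle u) = stake n (cycle v)" if "n \<le> length u + length v" for n
      using q stake_eq_mono that by fastforce
    have "stake (length u + length v) (cycle u) = u @ v"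
      using assms(1,2) *[of "length v"]
        stake_shift[of "length u + length v" u "cycle u"] by (simp add: cycle_unfold)
    moreover have "stake (length u + length v) (cycle v) = v @ u"
      using assms(1,2) *[of "length u"]
        stake_shift[of "length u + length v" v "cycle v"] by (simp add: cycle_unfold)
    ultimately have "u @ v = v @ u"
      using *[OF order_refl] by simp
    then show False
      using assms(1-3) cycle_eq_of_commute by blast
  qed
  have "Suc q \<le> length u + q"
    using assms(1) by (cases u) auto
  moreover have "stake (length u + q) (u @- cycle u) = stake (length u + q) (u @- cycle v)"
    using q by (simp add: stake_shift)
  ultimately have "stake (Suc q) (u @- cycle u) = stake (Suc q) (u @- cycle v)"
    using stake_eq_mono by blast
  \<comment> \<open>After \<open>u\<close>, the stream \<open>u @- v @- x\<close> is known to follow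
    \<open>cycle v\<close> only for \<open>length v\<close> letters; the bound on \<open>q\<close>
    makes these suffice.\<close>
  also have "stake (length u + length v) (u @- cycle v) = stake (length u + length v) (u @- v @- x)"
    using assms(2) by (simp add: stake_shift)
  then have "stake (Suc q) (u @- cycle v) = stake (Suc q) (u @- v @- x)"
    using bound stake_eq_mono by (metis Suc_leI)
  finally show ?thesis
    using assms(1) by (simp add: cycle_unfold)
qed

section \<open>The order on streams\<close>

definition sless :: "(nat \<Rightarrow> 'a rel) \<Rightarrow> 'a stream \<Rightarrow> 'a stream \<Rightarrow> bool" where
  "sless r x y \<longleftrightarrow> (\<exists>n. stake n x = stake n y \<and> (x !! n, y !! n) \<in> r (Suc n))"

definition sle :: "(nat \<Rightarrow> 'a rel) \<Rightarrow> 'a stream \<Rightarrow> 'a stream \<Rightarrow> bool" where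
  "sle r x y \<longleftrightarrow> sless r x y \<or> x = y"

lemma Inf_eq_conc_iff: "Inf x = u \<cdot> y \<longleftrightarrow> (\<exists>z. y = Inf z \<and> x = u @- z)"
  and conc_eq_Inf_iff: "u \<cdot> y = Inf x \<longleftrightarrow> (\<exists>z. y = Inf z \<and> x = u @- z)"
  by (cases y; auto)+

lemma Fin_eq_conc_iff: "Fin x = u \<cdot> y \<longleftrightarrow> (\<exists>z. y = Fin z \<and> x = u @ z)"
  and conc_eq_Fin_iff: "u \<cdot> y = Fin x \<longleftrightarrow> (\<exists>z. y = Fin z \<and> x = u @ z)"
  by (cases y; auto)+

lemma gless_Inf_iff: "gless r (Inf x) (Inf y) \<longleftrightarrow> sless r x y"
proof
  assume "gless r (Inf x) (Inf y)"
  then obtain p a b s s' where *: "x = p @- [a] @- s" "y = p @- [b] @- s'" "(a, b) \<in> r (length p + 1)"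
    by (auto simp: gless_def proper_prefix_def Inf_eq_conc_iff conc_eq_Inf_iff simp del: shift.simps)
  show "sless r x y"
    unfolding sless_def
    by (intro exI[of _ "length p"]) (use *(3) in \<open>simp add: *(1,2) stake_shift\<close>)
next
  assume "sless r x y"
  then obtain n where n: "stake n x = stake n y" "(x !! n, y !! n) \<in> r (Suc n)"
    by (auto simp: sless_def)
  have *: "Inf z = stake n z \<cdot> [z !! n] \<cdot> Inf (sdrop (Suc n) z)" for z :: "'a stream"
    using id_stake_snth_sdrop[of z n] by simp
  show "gless r (Inf x) (Inf y)"
    unfolding gless_def
    using *[of x] *[of y] n by (metis length_stake Suc_eq_plus1)
qed

lemma gle_Inf_iff: "gle r (Inf x) (Inf y) \<longleftrightarrow> sle r x y"
  by (simp add: gle_def sle_def gless_Inf_iff)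

text \<open>The first disagreement lies among the first \<open>n\<close> letters and alone decides
  the comparison.\<close>

lemma sless_cong_stake:
  assumes "stake n x = stake n x'" "stake n y = stake n y'" "stake n x \<noteq> stake n y"
  shows "sless r x y \<longleftrightarrow> sless r x' y'"
proof -
  have *: "sless r x' y'" if eq: "stake n x = stake n x'" "stake n y = stake n y'"
    and ne: "stake n x \<noteq> stake n y" and "sless r x y" for x x' y y' :: "'a stream"
  proof -
    from that obtain k where k: "stake k x = stake k y" "(x !! k, y !! k) \<in> r (Suc k)"
      by (auto simp: sless_def)
    have "k < n"
      using k(1) ne stake_eq_mono by (metis not_less)
    then have "x' !! k = x !! k" "y' !! k = y !! k" "stake k x' = stake k y'"
      using eq k(1) stake_eq_snth stake_eq_mono by (metis less_imp_le)+
    then show ?thesis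
      using k by (auto simp: sless_def)
  qed
  show ?thesis
    using *[of x x' y y'] *[of x' x y' y] assms by metis
qed

section \<open>Factorizations as sets of cuts\<close>

definition seg :: "'b stream \<Rightarrow> nat \<Rightarrow> nat \<Rightarrow> 'b list" where
  "seg w a b = stake (b - a) (sdrop a w)"

lemma length_seg [simp]: "length (seg w a b) = b - a"
  by (simp add: seg_def)

lemma seg_eq_Nil_iff [simp]: "seg w a b = [] \<longleftrightarrow> b \<le> a"
  by (simp add: seg_def)

lemma seg_append: "a \<le> b \<Longrightarrow> b \<le> c \<Longrightarrow> seg w a b @ seg w b c = seg w a c"
  using stake_add[of "b - a" "sdrop a w" "c - b"] by (simp add: seg_def)

lemma seg_shift_sdrop: "a \<le> b \<Longrightarrow> seg w a b @- sdrop b w = sdrop a w"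
  using stake_sdrop[of "b - a" "sdrop a w"] by (simp add: seg_def)

lemma drop_seg: "drop k (seg w a b) = seg w (a + k) b"
  by (simp add: seg_def drop_stake)

text \<open>
  For a cut \<open>a\<close>, \<open>omega_at w C a\<close> is the omega power of the factor starting at \<open>a\<close>; for any
  other position it is that of the rest of the factor containing the position.
\<close>

definition omega_at :: "'b stream \<Rightarrow> nat set \<Rightarrow> nat \<Rightarrow> 'b stream" where
  "omega_at w C a = (if \<exists>b\<in>C. a < b then cycle (seg w a (LEAST b. b \<in> C \<and> a < b)) else sdrop a w)"

lemma omega_at_next:
  assumes "b \<in> C" "a < b" "\<And>k. a < k \<Longrightarrow> k < b \<Longrightarrow> k \<notin> C"
  shows "omega_at w C a = cycle (seg w a b)"
proof -
  have "(LEAST b. b \<in> C \<and> a < b) = b"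
    using assms by (intro Least_equality) (auto simp: not_less[symmetric])
  then show ?thesis
    using assms by (auto simp: omega_at_def)
qed

lemma omega_at_last: "(\<And>b. b \<in> C \<Longrightarrow> b \<le> a) \<Longrightarrow> omega_at w C a = sdrop a w"
  by (auto simp: omega_at_def not_less[symmetric])

lemma next_cut_cases:
  obtains (cut) b where "b \<in> C" "(a::nat) < b" "\<And>k. a < k \<Longrightarrow> k < b \<Longrightarrow> k \<notin> C"
  | (last) "\<And>b. b \<in> C \<Longrightarrow> b \<le> a"
proof (cases "\<exists>b. b \<in> C \<and> a < b")
  case True
  then obtain b where "b \<in> C \<and> a < b" "\<forall>k<b. \<not> (k \<in> C \<and> a < k)"
    using exists_least_iff[of "\<lambda>b. b \<in> C \<and> a < b"] by blast
  then show thesis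
    using cut by blast
next
  case False
  then show thesis
    using last by (meson not_less)
qed

lemma previous_cut:
  assumes "0 \<in> C"
  obtains a where "a \<in> C" "a \<le> b" "\<And>k. a < k \<Longrightarrow> k \<le> (b::nat) \<Longrightarrow> k \<notin> C"
proof -
  let ?S = "{k \<in> C. k \<le> b}"
  have fin: "finite ?S" and "?S \<noteq> {}"
    using assms by auto
  then have "Max ?S \<in> ?S"
    by (rule Max_in)
  moreover have "k \<notin> C" if "Max ?S < k" "k \<le> b" for k
    using Max_ge[OF fin, of k] that leD by blast
  ultimately show thesis
    using that by blast
qed

section \<open>Sequences of factors and their starting positions\<close>

primrec factor :: "'b word \<Rightarrow> nat \<Rightarrow> 'b option" where
  "factor (Fin xs) i = (if i < length xs then Some (xs ! i) else None)"
| "factor (Inf xs) i = Some (xs !! i)"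

lemma factor_eqI:
  assumes "\<And>i. factor x i = factor y i"
  shows "x = y"
proof (cases x; cases y)
  fix xs ys assume *: "x = Fin xs" "y = Fin ys"
  then have "i < length xs \<longleftrightarrow> i < length ys" for i
    using assms[of i] by (auto split: if_splits)
  then have "length xs = length ys"
    by (meson linorder_neqE_nat less_irrefl)
  moreover have "xs ! i = ys ! i" if "i < length xs" for i
    using assms[of i] * that by (auto split: if_splits)
  ultimately show "x = y"
    using * nth_equalityI by blast
next
  fix xs ys assume "x = Fin xs" "y = Inf ys"
  then show "x = y"
    using assms[of "length xs"] by simp
next
  fix xs ys assume "x = Inf xs" "y = Fin ys"
  then show "x = y"
    using assms[of "length ys"] by simp
next
  fix xs ys assume "x = Inf xs" "y = Inf ys"
  then show "x = y"
    using assms by (auto intro: snth_ext)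
qed

lemma factor_in_factors: "factor ls i = Some l \<Longrightarrow> l \<in> factors ls"
  by (cases ls) (auto split: if_splits)

lemma nonincreasing_factor:
  assumes "nonincreasing r ls" "factor ls i = Some k" "factor ls (Suc i) = Some l"
  shows "gle r (omega_power l) (omega_power k)"
  using assms by (cases ls) (auto split: if_splits)

text \<open>Infinite and missing factors count as length 0, which keeps \<open>start\<close> total
  and monotone; \<open>cuts\<close> discards the indices without a factor.\<close>

primrec start :: "'b word word \<Rightarrow> nat \<Rightarrow> nat" where
  "start ls 0 = 0"
| "start ls (Suc i) = start ls i + (case factor ls i of Some (Fin u) \<Rightarrow> length u | _ \<Rightarrow> 0)"

definition cuts :: "'b word word \<Rightarrow> nat set" where
  "cuts ls = {start ls i | i. factor ls i \<noteq> None}"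

text \<open>Recovers a factor from the set of cuts and its starting position, with the same case
  distinction as \<open>omega_at\<close>.\<close>

definition factor_at :: "'b stream \<Rightarrow> nat set \<Rightarrow> nat \<Rightarrow> 'b word" where
  "factor_at w C a = (if \<exists>b\<in>C. a < b then Fin (seg w a (LEAST b. b \<in> C \<and> a < b)) else Inf (sdrop a w))"

lemma omega_power_factor_at: "omega_power (factor_at w C a) = Inf (omega_at w C a)"
  by (simp add: factor_at_def omega_at_def)

lemma factor_at_next:
  assumes "b \<in> C" "a < b" "\<And>k. a < k \<Longrightarrow> k < b \<Longrightarrow> k \<notin> C"
  shows "factor_at w C a = Fin (seg w a b)"
proof -
  have "(LEAST b. b \<in> C \<and> a < b) = b"
    using assms by (intro Least_equality) (auto simp: not_less[symmetric])
  then show ?thesis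
    using assms by (auto simp: factor_at_def)
qed

lemma sdrop_flat:
  assumes "[] \<notin> sset us"
  shows "sdrop (length (concat (stake i us))) (flat us) = flat (sdrop i us)"
  using assms
proof (induction i arbitrary: us)
  case (Suc i)
  obtain u us' where us: "us = u ## us'"
    by (cases us)
  then have "u \<noteq> []"
    using Suc.prems by auto
  then show ?case
    using Suc.IH[of us'] Suc.prems us by (simp add: sdrop_shift)
qed simp

text \<open>Excluding empty factors makes the starting positions strictly increasing, so distinct
  factors have distinct cuts.\<close>

locale stream_product =
  fixes ls :: "'a word word" and w :: "'a stream"
  assumes is_product: "is_product ls (Inf w)" and nonempty: "Fin [] \<notin> factors ls"
begin

lemma factor_0: "factor ls 0 \<noteq> None"
  using is_product by (cases ls) auto

lemma factor_cases:
  assumes "factor ls i = Some l"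
  obtains (Fin) "l = Fin (seg w (start ls i) (start ls (Suc i)))"
      "start ls i < start ls (Suc i)" "factor ls (Suc i) \<noteq> None"
  | (Inf) "l = Inf (sdrop (start ls i) w)" "factor ls (Suc i) = None"
proof -
  \<comment> \<open>Shared by finite and infinite sequences: a finite factor is read off from the
    rest of \<open>w\<close> at its start.\<close>
  have FinI: thesis if "l = Fin v" "sdrop (start ls i) w = v @- z" "factor ls (Suc i) \<noteq> None" for v z
  proof (rule Fin)
    have "v \<noteq> []"
      using factor_in_factors[OF assms] nonempty that(1) by metis
    then show "start ls i < start ls (Suc i)"
      using assms that(1) by simp
    show "l = Fin (seg w (start ls i) (start ls (Suc i)))"
      using assms that(1,2) by (simp add: seg_def stake_shift)
  qed (fact that(3))
  show thesis
  proof (cases ls)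
    case Fin': (Fin xs)
    then obtain us s where us: "xs = map Fin us @ [Inf s]" "w = concat us @- s"
      using is_product by (auto simp: Inf_eq_conc_iff)
    have start: "start ls j = length (concat (take j us))" if "j \<le> length us" for j
      using that
    proof (induction j)
      case (Suc j)
      then show ?case
        by (simp add: Fin' us(1) nth_append take_Suc_conv_app_nth)
    qed simp
    have rest: "sdrop (start ls j) w = concat (drop j us) @- s" if "j \<le> length us" for j
    proof -
      have "concat us = concat (take j us) @ concat (drop j us)"
        by (metis append_take_drop_id concat_append)
      then show ?thesis
        using start[OF that] us(2) by (simp add: sdrop_shift)
    qed
    show thesis
    proof (cases "i < length us")
      case True
      have "sdrop (start ls i) w = us ! i @- concat (drop (Suc i) us) @- s"
        using rest[of i] True by (simp add: Cons_nth_drop_Suc[symmetric])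
      moreover have "l = Fin (us ! i)" "factor ls (Suc i) \<noteq> None"
        using assms True Fin' us(1) by (auto simp: nth_append)
      ultimately show thesis
        by (intro FinI)
    next
      case False
      then have "i = length us"
        using assms Fin' us(1) by (auto split: if_splits)
      then show thesis
        using assms Fin' us(1) rest[of i] by (intro Inf) (auto simp: nth_append)
    qed
  next
    case Inf': (Inf xs)
    then obtain us where us: "xs = smap Fin us" "[] \<notin> sset us" "w = flat us"
      using is_product by auto
    have start: "start ls j = length (concat (stake j us))" for j
    proof (induction j)
      case (Suc j)
      then show ?case
        unfolding stake_Suc_snth using Inf' us(1) by simp
    qed simp
    have rest: "sdrop (start ls j) w = flat (sdrop j us)" for j
      using sdrop_flat[OF us(2)] start us(3) by simp
    have "us !! i \<noteq> []"
      using us(2) snth_sset by metis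
    then have "flat (sdrop i us) = us !! i @- flat (sdrop (Suc i) us)"
      using flat_unfold[of "sdrop i us"] by simp
    then have "sdrop (start ls i) w = us !! i @- flat (sdrop (Suc i) us)"
      using rest by metis
    moreover have "l = Fin (us !! i)" "factor ls (Suc i) \<noteq> None"
      using assms Inf' us(1) by auto
    ultimately show thesis
      by (intro FinI)
  qed
qed

lemma factor_Suc_D: "factor ls (Suc i) \<noteq> None \<Longrightarrow> factor ls i \<noteq> None"
  by (cases ls) (auto split: if_splits)

lemma start_less_Suc:
  assumes "factor ls (Suc i) \<noteq> None"
  shows "start ls i < start ls (Suc i)"
proof -
  obtain l where "factor ls i = Some l"
    using factor_Suc_D[OF assms] by blast
  then show ?thesis
    using assms by (cases rule: factor_cases) auto
qed

lemma start_mono: "i \<le> j \<Longrightarrow> start ls i \<le> start ls j"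
  by (rule lift_Suc_mono_le) auto

lemma factor_downward: "factor ls j \<noteq> None \<Longrightarrow> i \<le> j \<Longrightarrow> factor ls i \<noteq> None"
proof (induction j)
  case (Suc j)
  then show ?case
    using factor_Suc_D[of j] by (cases "i = Suc j") auto
qed simp

lemma start_in_cuts: "factor ls i \<noteq> None \<Longrightarrow> start ls i \<in> cuts ls"
  by (auto simp: cuts_def)

lemma no_cut_between:
  assumes "start ls i < k" "k < start ls (Suc i)"
  shows "k \<notin> cuts ls"
proof
  assume "k \<in> cuts ls"
  then obtain j where "k = start ls j"
    by (auto simp: cuts_def)
  then show False
    using assms start_mono[of j i] start_mono[of "Suc i" j] by linarith
qed

lemma no_cut_after_last:
  assumes "factor ls (Suc i) = None" "k \<in> cuts ls"
  shows "k \<le> start ls i"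
proof -
  obtain j where "k = start ls j" "factor ls j \<noteq> None"
    using assms(2) by (auto simp: cuts_def)
  then show ?thesis
    using assms(1) factor_downward[of j "Suc i"] start_mono[of j i] by linarith
qed

lemma factor_eq_factor_at:
  assumes "factor ls i = Some l"
  shows "l = factor_at w (cuts ls) (start ls i)"
  using assms
proof (cases rule: factor_cases)
  case Fin
  then show ?thesis
    using factor_at_next[of "start ls (Suc i)" "cuts ls" "start ls i"] start_in_cuts no_cut_between
    by metis
next
  case Inf
  then show ?thesis
    using no_cut_after_last by (auto simp: factor_at_def not_less[symmetric])
qed

end

text \<open>Along the indices, equal starts and equal cut sets force equal factors by
  \<open>factor_at\<close>, hence equal next starts. Both sequences stop together because exactly an
  infinite factor is last.\<close>

lemma stream_product_eqI:
  assumes "stream_product ls w" "stream_product ls' w" and cuts: "cuts ls = cuts ls'"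
  shows "ls = ls'"
proof (rule factor_eqI)
  interpret ls: stream_product ls w by fact
  interpret ls': stream_product ls' w by fact
  fix i
  have "factor ls i = factor ls' i \<and> start ls i = start ls' i"
  proof (induction i)
    case 0
    show ?case
      using ls.factor_0 ls'.factor_0 ls.factor_eq_factor_at[of 0] ls'.factor_eq_factor_at[of 0] cuts
      by fastforce
  next
    case (Suc i)
    then have start: "start ls (Suc i) = start ls' (Suc i)"
      by simp
    have "factor ls (Suc i) = None \<longleftrightarrow> factor ls' (Suc i) = None"
    proof (cases "factor ls i")
      case None
      then show ?thesis
        using Suc ls.factor_Suc_D ls'.factor_Suc_D by metis
    next
      case (Some l)
      then show ?thesis
        using ls.factor_cases[OF Some] ls'.factor_cases[of i l] Suc by (metis word.distinct(1))
    qed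
    then show ?case
      using start ls.factor_eq_factor_at[of "Suc i"] ls'.factor_eq_factor_at[of "Suc i"] cuts
      by (cases "factor ls (Suc i)"; cases "factor ls' (Suc i)") (auto simp del: start.simps)
  qed
  then show "factor ls i = factor ls' i" ..
qed

section \<open>The linear order on streams, and Lyndon words in terms of omega powers\<close>

locale letter_orders =
  fixes r :: "nat \<Rightarrow> 'a rel"
  assumes strict_linear_order_r: "n \<ge> 1 \<Longrightarrow> strict_linear_order (r n)"
begin

abbreviation slt (infix \<open>\<sqsubset>\<close> 50) where "x \<sqsubset> y \<equiv> sless r x y"
abbreviation sleq (infix \<open>\<sqsubseteq>\<close> 50) where "x \<sqsubseteq> y \<equiv> sle r x y"

lemma r_irrefl: "(a, a) \<notin> r (Suc n)"
  using strict_linear_order_r[of "Suc n"] by (auto simp: strict_linear_order_on_def irrefl_def)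

lemma r_trans: "(a, b) \<in> r (Suc n) \<Longrightarrow> (b, c) \<in> r (Suc n) \<Longrightarrow> (a, c) \<in> r (Suc n)"
  using strict_linear_order_r[of "Suc n"] by (auto simp: strict_linear_order_on_def dest: transD)

lemma r_total: "a \<noteq> b \<Longrightarrow> (a, b) \<in> r (Suc n) \<or> (b, a) \<in> r (Suc n)"
  using strict_linear_order_r[of "Suc n"] by (auto simp: strict_linear_order_on_def total_on_def)

lemma sless_irrefl: "\<not> x \<sqsubset> x"
  by (simp add: sless_def r_irrefl)

lemma sless_trans:
  assumes "x \<sqsubset> y" "y \<sqsubset> z"
  shows "x \<sqsubset> z"
proof -
  obtain m where m: "stake m x = stake m y" "(x !! m, y !! m) \<in> r (Suc m)"
    using assms(1) by (auto simp: sless_def)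
  obtain n where n: "stake n y = stake n z" "(y !! n, z !! n) \<in> r (Suc n)"
    using assms(2) by (auto simp: sless_def)
  consider "m < n" | "m = n" | "n < m" by linarith
  then show ?thesis
  proof cases
    case 1
    then have "stake m x = stake m z" "z !! m = y !! m"
      using m n stake_eq_mono stake_eq_snth by (metis less_imp_le)+
    then show ?thesis using m unfolding sless_def by metis
  next
    case 2
    then show ?thesis using m n r_trans unfolding sless_def by metis
  next
    case 3
    then have "stake n x = stake n z" "x !! n = y !! n"
      using m n stake_eq_mono stake_eq_snth by (metis less_imp_le)+
    then show ?thesis using n unfolding sless_def by metis
  qed
qed

lemma sless_total: "x \<noteq> y \<Longrightarrow> x \<sqsubset> y \<or> y \<sqsubset> x"
  by (metis first_disagreement r_total sless_def)

sublocale so: linorder "sle r" "sless r"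
proof
  fix x y z
  show "x \<sqsubset> y \<longleftrightarrow> x \<sqsubseteq> y \<and> \<not> y \<sqsubseteq> x"
    using sless_irrefl sless_trans unfolding sle_def by blast
  show "x \<sqsubseteq> x"
    by (simp add: sle_def)
  show "x \<sqsubseteq> y \<Longrightarrow> y \<sqsubseteq> z \<Longrightarrow> x \<sqsubseteq> z"
    using sless_trans unfolding sle_def by blast
  show "x \<sqsubseteq> y \<Longrightarrow> y \<sqsubseteq> x \<Longrightarrow> x = y"
    using sless_irrefl sless_trans unfolding sle_def by blast
  show "x \<sqsubseteq> y \<or> y \<sqsubseteq> x"
    using sless_total unfolding sle_def by blast
qed

text \<open>If \<open>y\<close> left the common prefix of \<open>x\<close> and \<open>z\<close>, it
  would compare in the same way with both and could not lie between them.\<close>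

lemma stake_eq_between:
  assumes "x \<sqsubseteq> y" "y \<sqsubseteq> z" "stake n x = stake n z"
  shows "stake n y = stake n x"
proof (rule ccontr)
  assume ne: "stake n y \<noteq> stake n x"
  then have "x \<sqsubset> y" "y \<sqsubset> z"
    using assms so.le_less by auto
  then have "z \<sqsubset> y"
    using sless_cong_stake[of n x z y y] assms(3) ne by metis
  then show False
    using \<open>y \<sqsubset> z\<close> by (simp add: so.less_asym)
qed

text \<open>Prepending \<open>u\<close> need not preserve the order, as the letter orders depend on
  the position. Instead, if \<open>y\<close> and \<open>cycle u\<close> first differ at
  \<open>n\<close>, then \<open>u @- y\<close> and \<open>u @- cycle u = cycle u\<close> agree
  beyond \<open>n\<close>, so one may replace the other in comparisons with
  \<open>y\<close>.\<close>

lemma shift_less_iff_cycle_less: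
  assumes "u \<noteq> []"
  shows "u @- y \<sqsubset> y \<longleftrightarrow> cycle u \<sqsubset> y" and "y \<sqsubset> u @- y \<longleftrightarrow> y \<sqsubset> cycle u"
proof -
  have "(u @- y \<sqsubset> y \<longleftrightarrow> cycle u \<sqsubset> y) \<and> (y \<sqsubset> u @- y \<longleftrightarrow> y \<sqsubset> cycle u)"
  proof (cases "cycle u = y")
    case True
    then show ?thesis
      using assms cycle_unfold by force
  next
    case False
    then obtain n where n: "stake n (cycle u) = stake n y" "cycle u !! n \<noteq> y !! n"
      using first_disagreement by blast
    then have "stake (length u + n) (u @- cycle u) = stake (length u + n) (u @- y)"
      by (simp add: stake_shift)
    moreover have "Suc n \<le> length u + n"
      using assms by (cases u) auto
    ultimately have "stake (Suc n) (cycle u) = stake (Suc n) (u @- y)"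
      using assms cycle_unfold stake_eq_mono by metis
    moreover have "stake (Suc n) (cycle u) \<noteq> stake (Suc n) y"
      using n(2) by (simp only: stake_Suc_eq_iff) simp
    ultimately show ?thesis
      using sless_cong_stake[of "Suc n" "cycle u" "u @- y" y y]
        sless_cong_stake[of "Suc n" y y "cycle u" "u @- y"] by metis
  qed
  then show "u @- y \<sqsubset> y \<longleftrightarrow> cycle u \<sqsubset> y" "y \<sqsubset> u @- y \<longleftrightarrow> y \<sqsubset> cycle u"
    by blast+
qed

text \<open>With \<open>y = cycle v\<close>, prepending \<open>u\<close> and prepending
  \<open>u @ v\<close> give the same stream, so both sides amount to comparing
  \<open>u @- cycle v\<close> with \<open>cycle v\<close>.\<close>

lemma cycle_append_less_iff:
  assumes "u \<noteq> []" "v \<noteq> []"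
  shows "cycle (u @ v) \<sqsubset> cycle v \<longleftrightarrow> cycle u \<sqsubset> cycle v"
    and "cycle v \<sqsubset> cycle (u @ v) \<longleftrightarrow> cycle v \<sqsubset> cycle u"
  using shift_less_iff_cycle_less[of u "cycle v"] shift_less_iff_cycle_less[of "u @ v" "cycle v"]
    assms cycle_unfold[of v] by auto

text \<open>The two words of equal length are padded to streams without affecting their comparison.
  The padding is chosen so that, with \<open>Z = cycle (u @ v)\<close>, the padded streams are
  \<open>Z\<close> and \<open>v @- Z\<close>.\<close>

lemma gless_swap_iff:
  assumes "u \<noteq> []" "v \<noteq> []"
  shows "gless r (Fin (u @ v)) (Fin (v @ u)) \<longleftrightarrow> cycle (u @ v) \<sqsubset> cycle v"
proof -
  let ?Z = "cycle (u @ v)"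
  have "gless r (Fin (u @ v)) (Fin (v @ u)) \<longleftrightarrow> (u @ v) @- ?Z \<sqsubset> (v @ u) @- v @- ?Z"
  proof
    assume *: "gless r (Fin (u @ v)) (Fin (v @ u))"
    have "\<not> proper_prefix (Fin (u @ v)) (Fin (v @ u))"
      by (auto simp: proper_prefix_def Fin_eq_conc_iff dest!: arg_cong[of _ _ length])
    with * obtain p a b s s' where eq: "u @ v = p @ [a] @ s" "v @ u = p @ [b] @ s'"
      and ab: "(a, b) \<in> r (length p + 1)"
      by (auto simp: gless_def Fin_eq_conc_iff conc_eq_Fin_iff)
    have "gless r (Inf ((u @ v) @- z)) (Inf ((v @ u) @- z'))" for z z'
      unfolding gless_def eq using ab
      by (intro disjI2 exI[of _ p] exI[of _ a] exI[of _ b] exI[of _ "Inf (s @- z)"]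
          exI[of _ "Inf (s' @- z')"]) simp
    then show "(u @ v) @- ?Z \<sqsubset> (v @ u) @- v @- ?Z"
      by (simp only: gless_Inf_iff)
  next
    assume *: "(u @ v) @- ?Z \<sqsubset> (v @ u) @- v @- ?Z"
    then obtain n where n: "stake n ((u @ v) @- ?Z) = stake n ((v @ u) @- v @- ?Z)"
      "(((u @ v) @- ?Z) !! n, ((v @ u) @- v @- ?Z) !! n) \<in> r (Suc n)"
      by (auto simp: sless_def simp del: shift_append)
    \<comment> \<open>A disagreement only in the padding would mean that \<open>u\<close> and
      \<open>v\<close> commute, and then the padded streams coincide.\<close>
    have len: "n < length (u @ v)"
    proof (rule ccontr)
      assume "\<not> n < length (u @ v)"
      then have "stake (length (u @ v)) ((u @ v) @- ?Z) = stake (length (u @ v)) ((v @ u) @- v @- ?Z)"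
        using n(1) stake_eq_mono by (metis not_less)
      then have "u @ v = v @ u"
        by (simp add: stake_shift)
      then have "cycle u = cycle v" 
        using assms cycle_eq_of_commute by blast
      then have "(u @ v) @- ?Z = (v @ u) @- v @- ?Z"
        using assms \<open>u @ v = v @ u\<close> by (metis append_is_Nil_conv cycle_unfold cycle_unique shift_append)
      then show False
        using * so.less_irrefl by metis
    qed
    let ?x = "u @ v" and ?y = "v @ u"
    have "take n ?x = take n ?y" "(?x ! n, ?y ! n) \<in> r (length (take n ?x) + 1)"
      using n len by (simp_all add: stake_shift shift_snth del: shift_append take_append)
    moreover have "Fin ?x = take n ?x \<cdot> [?x ! n] \<cdot> Fin (drop (Suc n) ?x)"
      "Fin ?y = take n ?y \<cdot> [?y ! n] \<cdot> Fin (drop (Suc n) ?y)"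
      using len id_take_nth_drop[of n ?x] id_take_nth_drop[of n ?y]
      by (simp_all add: add.commute del: take_append drop_append)
    ultimately show "gless r (Fin ?x) (Fin ?y)"
      unfolding gless_def by metis
  qed
  also have "\<dots> \<longleftrightarrow> ?Z \<sqsubset> v @- ?Z"
    using assms by (simp add: cycle_append_unfold)
  also have "\<dots> \<longleftrightarrow> ?Z \<sqsubset> cycle v"
    using assms shift_less_iff_cycle_less by blast
  finally show ?thesis .
qed

lemma generalized_Lyndon_Fin_iff:
  "generalized_Lyndon r (Fin w) \<longleftrightarrow>
    w \<noteq> [] \<and> (\<forall>k. 0 < k \<longrightarrow> k < length w \<longrightarrow> cycle w \<sqsubset> cycle (drop k w))"
  (is "_ \<longleftrightarrow> w \<noteq> [] \<and> ?R")
proof -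
  have "(\<forall>u v. w = u @ v \<longrightarrow> u \<noteq> [] \<longrightarrow> v \<noteq> [] \<longrightarrow> cycle w \<sqsubset> cycle v) \<longleftrightarrow> ?R"
  proof safe
    fix k assume "\<forall>u v. w = u @ v \<longrightarrow> u \<noteq> [] \<longrightarrow> v \<noteq> [] \<longrightarrow> cycle w \<sqsubset> cycle v"
      "0 < k" "k < length w"
    then show "cycle w \<sqsubset> cycle (drop k w)"
      by (metis append_take_drop_id drop_eq_Nil not_less take_eq_Nil length_0_conv less_nat_zero_code)
  next
    fix u v assume "\<forall>k. 0 < k \<longrightarrow> k < length (u @ v) \<longrightarrow> cycle (u @ v) \<sqsubset> cycle (drop k (u @ v))"
      "u \<noteq> []" "v \<noteq> []" "w = u @ v"
    then show "cycle (u @ v) \<sqsubset> cycle v"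
      by (auto dest!: spec[of _ "length u"])
  qed
  then show ?thesis
    using gless_swap_iff by auto
qed

lemma generalized_Lyndon_Inf_iff:
  "generalized_Lyndon r (Inf w) \<longleftrightarrow> (\<forall>k. 0 < k \<longrightarrow> w \<sqsubset> sdrop k w)"
proof safe
  fix k :: nat assume "generalized_Lyndon r (Inf w)" "0 < k"
  then show "w \<sqsubset> sdrop k w"
    by (simp add: gless_Inf_iff) (metis stake_sdrop stake_invert_Nil not_less_zero)
next
  assume *: "\<forall>k. 0 < k \<longrightarrow> w \<sqsubset> sdrop k w"
  have "w \<sqsubset> v" if "w = u @- v" "u \<noteq> []" for u v
    using *[rule_format, of "length u"] that by (simp add: sdrop_shift)
  then show "generalized_Lyndon r (Inf w)"
    by (simp add: gless_Inf_iff)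
qed

lemma not_generalized_Lyndon_Nil [simp]: "\<not> generalized_Lyndon r (Fin [])"
  by simp

declare generalized_Lyndon.simps [simp del]

section \<open>Uniqueness of the set of cuts\<close>

text \<open>The second conjunct says that the factors are Lyndon, the third that they are
  nonincreasing. Using \<open>omega_at\<close> treats finite factors and a final infinite factor
  alike.\<close>

definition Lyndon_cuts :: "'a stream \<Rightarrow> nat set \<Rightarrow> bool" where
  "Lyndon_cuts w C \<longleftrightarrow> 0 \<in> C \<and>
    (\<forall>a\<in>C. \<forall>b>a. {a<..b} \<inter> C = {} \<longrightarrow> omega_at w C a \<sqsubset> omega_at w C b) \<and>
    (\<forall>a\<in>C. \<forall>b\<in>C. a < b \<longrightarrow> {a<..<b} \<inter> C = {} \<longrightarrow> omega_at w C b \<sqsubseteq> omega_at w C a)"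

text \<open>The word from \<open>a\<close> is \<open>seg w a b\<close> followed by the word from
  \<open>b\<close>, so the whole may be replaced by its prefix as in
  \<open>cycle_append_less_iff\<close>, or as in \<open>shift_less_iff_cycle_less\<close> for an
  infinite rest.\<close>

lemma omega_at_less_iff:
  assumes "a < b" "\<And>k. a < k \<Longrightarrow> k \<le> b \<Longrightarrow> k \<notin> C"
  shows "omega_at w C a \<sqsubset> omega_at w C b \<longleftrightarrow> cycle (seg w a b) \<sqsubset> omega_at w C b"
proof (cases rule: next_cut_cases[of C b])
  case (cut d)
  then have "omega_at w C a = cycle (seg w a d)"
    using assms by (intro omega_at_next) (auto, metis not_le)
  moreover have "omega_at w C b = cycle (seg w b d)"
    using cut by (intro omega_at_next)
  ultimately show ?thesis
    using cycle_append_less_iff(1)[of "seg w a b" "seg w b d"] assms(1) cut(2)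
    by (simp add: seg_append)
next
  case last
  then have "omega_at w C b = sdrop b w" "omega_at w C a = sdrop a w"
    using assms by (auto intro!: omega_at_last) (metis not_le)
  then show ?thesis
    using shift_less_iff_cycle_less(1)[of "seg w a b" "sdrop b w"] assms(1)
    by (simp add: seg_shift_sdrop)
qed

lemma cycle_le_append:
  assumes "u \<noteq> []" "v \<noteq> []" "cycle v \<sqsubseteq> cycle u"
  shows "cycle v \<sqsubseteq> cycle (u @ v)"
  using cycle_append_less_iff(1)[OF assms(1,2)] assms(3) so.not_less by blast

text \<open>Let \<open>p\<close> be the cut before \<open>b\<close>; by monotonicity it suffices to
  bound by \<open>omega_at w C p\<close>. If \<open>a\<close> lies inside the factor from
  \<open>p\<close>, that factor is Lyndon; if \<open>a < p\<close>, the bound at \<open>p\<close>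
  extends by \<open>cycle_le_append\<close>.\<close>

lemma Lyndon_cuts_ending_at:
  assumes C: "Lyndon_cuts w C" and "b \<in> C" "a < b"
  shows "omega_at w C b \<sqsubseteq> cycle (seg w a b)"
  using assms(2,3)
proof (induction b arbitrary: a rule: less_induct)
  case (less b)
  \<comment> \<open>Searching up to \<open>b - 1\<close> excludes the cut \<open>b\<close>
    itself.\<close>
  obtain p where p: "p \<in> C" "p \<le> b - 1" "\<And>k. p < k \<Longrightarrow> k \<le> b - 1 \<Longrightarrow> k \<notin> C"
    using C previous_cut[of C "b - 1"] by (auto simp: Lyndon_cuts_def)
  have "p < b"
    using p(2) less.prems by linarith
  have gap: "k \<notin> C" if "p < k" "k < b" for k
    using p(3)[of k] that by linarith
  have p_eq: "omega_at w C p = cycle (seg w p b)"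
    using less.prems(1) \<open>p < b\<close> gap by (rule omega_at_next)
  have "{p<..<b} \<inter> C = {}"
    using gap by auto
  then have "omega_at w C b \<sqsubseteq> omega_at w C p"
    using C p(1) less.prems(1) \<open>p < b\<close> by (auto simp: Lyndon_cuts_def)
  also have "omega_at w C p \<sqsubseteq> cycle (seg w a b)"
  proof (cases a p rule: linorder_cases)
    case less': less
    then have "cycle (seg w p b) \<sqsubseteq> cycle (seg w a p)"
      using less.IH[OF \<open>p < b\<close> p(1)] p_eq by simp
    then have "cycle (seg w p b) \<sqsubseteq> cycle (seg w a p @ seg w p b)"
      using less' \<open>p < b\<close> by (intro cycle_le_append) auto
    then show ?thesis
      using less' \<open>p < b\<close> p_eq by (simp add: seg_append)
  next
    case equal
    then show ?thesis using p_eq by simp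
  next
    case greater
    then have "{p<..a} \<inter> C = {}"
      using gap less.prems(2) by auto
    then have "omega_at w C p \<sqsubset> omega_at w C a"
      using C p(1) greater by (auto simp: Lyndon_cuts_def)
    also have "omega_at w C a = cycle (seg w a b)"
      using less.prems gap greater by (intro omega_at_next) auto
    finally show ?thesis by simp
  qed
  finally show ?case .
qed

text \<open>
  The last cut before a cut \<open>b\<close> depends only on \<open>b\<close>: it starts the shortest suffix of the
  first \<open>b\<close> letters whose omega power is minimal.
\<close>

lemma previous_cut_not_less:
  assumes C: "Lyndon_cuts w C" and C': "Lyndon_cuts w C'"
    and a: "a \<in> C" "a < b" "b \<in> C" "{a<..<b} \<inter> C = {}"
    and a': "a' \<in> C'" "a' < b" "b \<in> C'" "{a'<..<b} \<inter> C' = {}"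
  shows "\<not> a < a'"
proof
  assume "a < a'"
  have eq: "omega_at w C a = cycle (seg w a b)" "omega_at w C a' = cycle (seg w a' b)"
    "omega_at w C' a' = cycle (seg w a' b)"
    using a a' \<open>a < a'\<close> by (auto simp: disjoint_iff intro!: omega_at_next)
  have "{a<..a'} \<inter> C = {}"
    using a(4) a'(2) by (auto simp: disjoint_iff)
  then have "cycle (seg w a b) \<sqsubset> cycle (seg w a' b)"
    using C a(1) \<open>a < a'\<close> eq unfolding Lyndon_cuts_def by metis
  \<comment> \<open>Since \<open>a'\<close> is a cut of \<open>C'\<close>, every word ending there
    is bounded below, which reverses the strict inequality coming from \<open>C\<close>.\<close>
  moreover have "cycle (seg w a' b) \<sqsubseteq> cycle (seg w a a')"
    using Lyndon_cuts_ending_at[OF C' a'(1) \<open>a < a'\<close>] eq by simp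
  then have "cycle (seg w a' b) \<sqsubseteq> cycle (seg w a a' @ seg w a' b)"
    using \<open>a < a'\<close> a'(2) by (intro cycle_le_append) auto
  then have "cycle (seg w a' b) \<sqsubseteq> cycle (seg w a b)"
    using \<open>a < a'\<close> a'(2) by (simp add: seg_append)
  ultimately show False
    by simp
qed

lemma cuts_below_common_cut:
  assumes C: "Lyndon_cuts w C" and C': "Lyndon_cuts w C'" and "b \<in> C" "b \<in> C'" "k \<le> b"
  shows "k \<in> C \<longleftrightarrow> k \<in> C'"
  using assms(3-5)
proof (induction b rule: less_induct)
  case (less b)
  show ?case
  proof (cases "k = b")
    case False
    then have "k < b"
      using less.prems by simp
    obtain a where a: "a \<in> C" "a \<le> b - 1" "\<And>k. a < k \<Longrightarrow> k \<le> b - 1 \<Longrightarrow> k \<notin> C"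
      using C previous_cut[of C "b - 1"] by (auto simp: Lyndon_cuts_def)
    obtain a' where a': "a' \<in> C'" "a' \<le> b - 1" "\<And>k. a' < k \<Longrightarrow> k \<le> b - 1 \<Longrightarrow> k \<notin> C'"
      using C' previous_cut[of C' "b - 1"] by (auto simp: Lyndon_cuts_def)
    have "{a<..<b} \<inter> C = {}" "{a'<..<b} \<inter> C' = {}"
      using a(3) a'(3) by fastforce+
    moreover have "a < b" "a' < b"
      using a(2) a'(2) \<open>k < b\<close> by linarith+
    ultimately have "a = a'"
      using previous_cut_not_less[of w C C' a b a'] previous_cut_not_less[of w C' C a' b a]
        C C' a(1) a'(1) less.prems by (meson linorder_neqE_nat)
    show ?thesis
    proof (cases "k \<le> a")
      case True
      then show ?thesis
        using less.IH[of a] \<open>a < b\<close> a(1) a'(1) \<open>a = a'\<close> by simp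
    next
      case False
      then show ?thesis
        using a(3)[of k] a'(3)[of k] \<open>a = a'\<close> \<open>k < b\<close> by auto
    qed
  qed (use less.prems in simp)
qed

text \<open>The strict part uses the factor of \<open>C'\<close> that starts at some
  \<open>p <= c\<close> and runs past \<open>d\<close>: being Lyndon, it gives the bound for
  \<open>seg w p d\<close>. If \<open>p < c\<close>, then \<open>c\<close> is a cut of
  \<open>C\<close>, and the lower bound for words ending at \<open>c\<close> passes from
  \<open>seg w p d\<close> to \<open>seg w c d\<close>.\<close>

lemma separating_cut:
  assumes C: "Lyndon_cuts w C" and C': "Lyndon_cuts w C'"
    and c: "c \<in> C \<union> C'" "c < d" and d: "d \<in> C" "d \<notin> C'" and gap: "{c<..<d} \<inter> (C \<union> C') = {}"
  shows "omega_at w C d \<sqsubseteq> cycle (seg w c d)" "cycle (seg w c d) \<sqsubset> omega_at w C' d"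
proof -
  show "omega_at w C d \<sqsubseteq> cycle (seg w c d)"
    using Lyndon_cuts_ending_at C d(1) c(2) by blast
  obtain p where p: "p \<in> C'" "p \<le> c" "\<And>k. p < k \<Longrightarrow> k \<le> c \<Longrightarrow> k \<notin> C'"
    using C' previous_cut[of C' c] by (auto simp: Lyndon_cuts_def)
  have no_cut: "k \<notin> C'" if "p < k" "k \<le> d" for k
  proof (cases k d rule: linorder_cases)
    case less
    then show ?thesis
      using p(3)[of k] gap that by (cases "k \<le> c") (auto simp: disjoint_iff)
  qed (use d that in auto)
  then have "{p<..d} \<inter> C' = {}"
    by auto
  then have "omega_at w C' p \<sqsubset> omega_at w C' d"
    using C' p(1,2) c(2) by (auto simp: Lyndon_cuts_def)
  then have *: "cycle (seg w p d) \<sqsubset> omega_at w C' d"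
    using omega_at_less_iff[of p d C' w] no_cut p(2) c(2) by auto
  have "cycle (seg w c d) \<sqsubseteq> cycle (seg w p d)"
  proof (cases "p = c")
    case False
    then have "p < c" "c \<in> C"
      using p(2) p(3)[of c] c(1) by auto
    moreover have "omega_at w C c = cycle (seg w c d)"
      using c d gap by (intro omega_at_next) auto
    ultimately have "cycle (seg w c d) \<sqsubseteq> cycle (seg w p c)"
      using Lyndon_cuts_ending_at[OF C, of c p] by simp
    then have "cycle (seg w c d) \<sqsubseteq> cycle (seg w p c @ seg w c d)"
      using \<open>p < c\<close> c(2) by (intro cycle_le_append) auto
    then show ?thesis
      using \<open>p < c\<close> c(2) by (simp add: seg_append)
  qed simp
  then show "cycle (seg w c d) \<sqsubset> omega_at w C' d"
    using * by (rule so.le_less_trans)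
qed

text \<open>By \<open>separating_cut\<close>, \<open>cycle (seg w c d)\<close> is squeezed between
  the two streams at \<open>d\<close>, so it shares their common prefix. Prepending
  \<open>seg w c d\<close> then gains at least one letter.\<close>

lemma stake_omega_at_step:
  assumes C: "Lyndon_cuts w C" and C': "Lyndon_cuts w C'"
    and c: "c \<in> C \<union> C'" "c < d" and d: "d \<in> C" "d \<notin> C'" and gap: "{c<..<d} \<inter> (C \<union> C') = {}"
    and eq: "stake q (omega_at w C d) = stake q (omega_at w C' d)"
  shows "stake (Suc q) (omega_at w C c) = stake (Suc q) (omega_at w C' c)"
proof -
  let ?y = "seg w c d"
  note sep = separating_cut[OF C C' c d gap]
  have "stake q (cycle ?y) = stake q (omega_at w C d)"
    using sep by (intro stake_eq_between[OF _ _ eq]) auto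
  then have y: "stake q (cycle ?y) = stake q (omega_at w C' d)"
    using eq by simp
  have "omega_at w C c = cycle ?y"
    using c d gap by (intro omega_at_next) auto
  moreover have "stake (Suc q) (cycle ?y) = stake (Suc q) (omega_at w C' c)"
  proof (cases rule: next_cut_cases[of C' d])
    case (cut e)
    have "omega_at w C' d = cycle (seg w d e)"
      using cut by (intro omega_at_next)
    moreover have "k \<notin> C'" if "c < k" "k < e" for k
      using cut(3)[of k] d(2) gap that by (cases k d rule: linorder_cases) auto
    then have "omega_at w C' c = cycle (seg w c e)"
      using cut c(2) by (intro omega_at_next) auto
    then have "omega_at w C' c = ?y @- seg w d e @- cycle (?y @ seg w d e)"
      using c(2) cut(2) by (simp add: cycle_append_unfold) (simp add: seg_append)
    \<comment> \<open>The strict inequality of \<open>separating_cut\<close> ensures that the two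
      cycles differ, as \<open>stake_Suc_cycle\<close> requires.\<close>
    ultimately show ?thesis
      using stake_Suc_cycle[of ?y "seg w d e" q] y sep(2) c(2) cut(2) so.less_irrefl
      by (metis seg_eq_Nil_iff not_le)
  next
    case last
    have "k \<le> c" if "k \<in> C'" for k
      using last[OF that] d(2) gap that by (cases "k \<le> c"; cases "k = d") (auto simp: disjoint_iff)
    then have "omega_at w C' c = sdrop c w"
      by (rule omega_at_last)
    moreover have "omega_at w C' d = sdrop d w"
      using last by (rule omega_at_last)
    ultimately have "omega_at w C' c = ?y @- omega_at w C' d"
      using c(2) by (simp add: seg_shift_sdrop)
    moreover have "stake (length ?y + q) (?y @- cycle ?y) = stake (length ?y + q) (?y @- omega_at w C' d)"
      using y by (simp only: stake_shift_eq_iff)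
    ultimately have "stake (length ?y + q) (cycle ?y) = stake (length ?y + q) (omega_at w C' c)"
      using c(2) cycle_unfold[of ?y] by simp
    moreover have "Suc q \<le> length ?y + q"
      using c(2) by simp
    ultimately show ?thesis
      using stake_eq_mono by blast
  qed
  ultimately show ?thesis
    by metis
qed

text \<open>Induction on the length of agreement, for all cuts \<open>c\<close> at once: agreement
  on \<open>q\<close> letters at the next cut of the union yields \<open>q + 1\<close> letters at
  \<open>c\<close>. Without a next cut both sides are the rest of \<open>w\<close>.\<close>

lemma omega_at_eq_beyond_common_cut:
  assumes C: "Lyndon_cuts w C" and C': "Lyndon_cuts w C'"
    and no_common: "\<And>k. a < k \<Longrightarrow> \<not> (k \<in> C \<and> k \<in> C')"
    and c: "c \<in> C \<union> C'" "a \<le> c"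
  shows "omega_at w C c = omega_at w C' c"
proof (rule stake_eq_all)
  fix q
  show "stake q (omega_at w C c) = stake q (omega_at w C' c)"
    using c
  proof (induction q arbitrary: c)
    case (Suc q)
    show ?case
    proof (cases rule: next_cut_cases[of "C \<union> C'" c])
      case (cut d)
      then have gap: "{c<..<d} \<inter> (C \<union> C') = {}" "{c<..<d} \<inter> (C' \<union> C) = {}"
        by auto
      have eq: "stake q (omega_at w C d) = stake q (omega_at w C' d)"
        using Suc cut by simp
      have "d \<in> C \<and> d \<notin> C' \<or> d \<in> C' \<and> d \<notin> C"
        using cut no_common[of d] Suc.prems by auto
      then show ?thesis
        using stake_omega_at_step[of w C C' c d q] stake_omega_at_step[of w C' C c d q]
          C C' gap eq cut Suc.prems by (metis Un_commute)
    next
      case last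
      then have "omega_at w C c = sdrop c w" "omega_at w C' c = sdrop c w"
        by (auto intro: omega_at_last)
      then show ?thesis
        by simp
    qed
  qed simp
qed

lemma Lyndon_cuts_unique:
  assumes C: "Lyndon_cuts w C" and C': "Lyndon_cuts w C'"
  shows "C = C'"
proof (cases "finite (C \<inter> C')")
  case False
  have "k \<in> C \<longleftrightarrow> k \<in> C'" for k
  proof -
    obtain b where "b \<in> C \<inter> C'" "k \<le> b"
      using False unfolding finite_nat_set_iff_bounded_le by (meson nat_le_linear)
    then show ?thesis
      using cuts_below_common_cut[OF C C'] by blast
  qed
  then show ?thesis
    by blast
next
  case True
  define a where "a = Max (C \<inter> C')"
  have "0 \<in> C \<inter> C'"
    using C C' by (auto simp: Lyndon_cuts_def)
  then have a: "a \<in> C \<inter> C'"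
    unfolding a_def using True by (intro Max_in) auto
  have no_common: "\<not> (k \<in> C \<and> k \<in> C')" if "a < k" for k
    using Max_ge[OF True, of k] that by (auto simp: a_def)
  show ?thesis
  proof (cases rule: next_cut_cases[of "C \<union> C'" a])
    case (cut d)
    then have gap: "{a<..<d} \<inter> (C \<union> C') = {}" "{a<..<d} \<inter> (C' \<union> C) = {}"
      by auto
    \<comment> \<open>Only one of the sets contains \<open>d\<close>, so
      \<open>separating_cut\<close> makes these two streams strictly ordered, contradicting their
      equality.\<close>
    have "omega_at w C d = omega_at w C' d"
      using omega_at_eq_beyond_common_cut[OF C C' no_common cut(1)] cut(2) by simp
    moreover have "d \<in> C \<and> d \<notin> C' \<or> d \<in> C' \<and> d \<notin> C"
      using cut no_common[of d] by auto
    ultimately have False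
      using separating_cut[OF C C' _ cut(2) _ _ gap(1)] separating_cut[OF C' C _ cut(2) _ _ gap(2)] a
      by (metis IntD1 IntD2 UnI1 so.not_less)
    then show ?thesis ..
  next
    case last
    have "k \<in> C \<longleftrightarrow> k \<in> C'" for k
      using cuts_below_common_cut[OF C C', of a k] a last[of k] by blast
    then show ?thesis
      by blast
  qed
qed

section \<open>From factorizations to sets of cuts\<close>

lemma Lyndon_cuts_of_factorization:
  assumes fact: "nonincreasing_Lyndon_factorization r ls (Inf w)"
  shows "stream_product ls w" and "Lyndon_cuts w (cuts ls)"
proof -
  have Lyndon: "generalized_Lyndon r l" if "l \<in> factors ls" for l
    using fact that by (auto simp: nonincreasing_Lyndon_factorization_def)
  show "stream_product ls w"
    using fact Lyndon[of "Fin []"]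
    by unfold_locales (auto simp: nonincreasing_Lyndon_factorization_def generalized_Lyndon_Fin_iff)
  then interpret stream_product ls w .
  let ?C = "cuts ls"
  have omega: "omega_power l = Inf (omega_at w ?C (start ls i))" if "factor ls i = Some l" for i l
    using factor_eq_factor_at[OF that] omega_power_factor_at by metis
  show "Lyndon_cuts w ?C"
    unfolding Lyndon_cuts_def
  proof (intro conjI ballI allI impI)
    show "0 \<in> ?C"
      using start_in_cuts[OF factor_0] by simp
  next
    fix a b assume "a \<in> ?C" "a < b" and gap: "{a<..b} \<inter> ?C = {}"
    then obtain i l where a: "a = start ls i" and l: "factor ls i = Some l"
      by (auto simp: cuts_def)
    note L = Lyndon[OF factor_in_factors[OF l]]
    show "omega_at w ?C a \<sqsubset> omega_at w ?C b"
      using l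
    proof (cases rule: factor_cases)
      case Fin
      let ?d = "start ls (Suc i)"
      have "?d \<in> ?C"
        using Fin start_in_cuts by blast
      then have "b < ?d"
        using gap Fin(2) a by (metis IntI empty_iff greaterThanAtMost_iff not_le)
      have "k \<notin> ?C" if "a < k" "k < ?d" for k
        using no_cut_between that unfolding a by blast
      then have "omega_at w ?C b = cycle (seg w b ?d)"
        using \<open>a < b\<close> \<open>b < ?d\<close> \<open>?d \<in> ?C\<close> by (meson omega_at_next less_trans)
      moreover have "omega_at w ?C a = cycle (seg w a ?d)"
        using \<open>?d \<in> ?C\<close> a Fin(2) no_cut_between by (intro omega_at_next) blast+
      moreover have "cycle (seg w a ?d) \<sqsubset> cycle (drop (b - a) (seg w a ?d))"
        using L \<open>a < b\<close> \<open>b < ?d\<close> unfolding Fin(1) generalized_Lyndon_Fin_iff a[symmetric] length_seg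
        by (meson diff_less_mono less_imp_le zero_less_diff)
      ultimately show ?thesis
        using \<open>a < b\<close> by (simp add: drop_seg)
    next
      case Inf
      have "k \<le> a" if "k \<in> ?C" for k
        using no_cut_after_last[OF Inf(2) that] a by simp
      then have "omega_at w ?C a = sdrop a w" "omega_at w ?C b = sdrop b w"
        using \<open>a < b\<close> by (meson omega_at_last le_trans less_imp_le)+
      moreover have "sdrop a w \<sqsubset> sdrop (b - a) (sdrop a w)"
        using L \<open>a < b\<close> unfolding Inf(1) generalized_Lyndon_Inf_iff a[symmetric]
        by (metis le_add_diff_inverse less_imp_le sdrop_add zero_less_diff)
      ultimately show ?thesis
        using \<open>a < b\<close> by simp
    qed
  next
    fix a b assume "a \<in> ?C" "b \<in> ?C" "a < b" and gap: "{a<..<b} \<inter> ?C = {}"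
    then obtain i k j l where a: "a = start ls i" "factor ls i = Some k"
      and b: "b = start ls j" "factor ls j = Some l"
      by (auto simp: cuts_def)
    have "i < j"
      using \<open>a < b\<close> a b start_mono[of j i] by (meson not_le)
    then have act: "factor ls (Suc i) \<noteq> None"
      using factor_downward[of j "Suc i"] b by simp
    then have "start ls (Suc i) \<in> ?C" "a < start ls (Suc i)"
      using start_in_cuts[OF act] start_less_Suc[OF act] a by simp_all
    moreover have "start ls (Suc i) \<le> b"
      using start_mono[of "Suc i" j] \<open>i < j\<close> b by simp
    ultimately have b': "b = start ls (Suc i)"
      using gap by (metis IntI empty_iff greaterThanLessThan_iff le_neq_implies_less)
    obtain l' where l': "factor ls (Suc i) = Some l'"
      using act by blast
    have "gle r (omega_power l') (omega_power k)"
      using nonincreasing_factor a(2) l' fact by (auto simp: nonincreasing_Lyndon_factorization_def)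
    then show "omega_at w ?C b \<sqsubseteq> omega_at w ?C a"
      using omega[OF a(2)] omega[OF l'] a b' by (simp add: gle_Inf_iff del: start.simps)
  qed
qed

lemma nonincreasing_Lyndon_factorization_unique:
  assumes "nonincreasing_Lyndon_factorization r ls (Inf w)"
    and "nonincreasing_Lyndon_factorization r ls' (Inf w)"
  shows "ls = ls'"
  using assms Lyndon_cuts_of_factorization Lyndon_cuts_unique stream_product_eqI by metis

section \<open>Existence\<close>

definition Lyndon_list :: "'a list list \<Rightarrow> bool" where
  "Lyndon_list us \<longleftrightarrow> (\<forall>u \<in> set us. generalized_Lyndon r (Fin u)) \<and>
    successively (\<lambda>u v. cycle v \<sqsubseteq> cycle u) us"

lemma Lyndon_list_append_D: "Lyndon_list (us @ vs) \<Longrightarrow> Lyndon_list us"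
  by (simp add: Lyndon_list_def successively_append_iff)

lemma shortest_minimal_suffix:
  assumes "x \<noteq> []"
  obtains k where "k < length x"
    and "\<And>j. j < length x \<Longrightarrow> cycle (drop k x) \<sqsubseteq> cycle (drop j x)"
    and "\<And>j. k < j \<Longrightarrow> j < length x \<Longrightarrow> cycle (drop k x) \<sqsubset> cycle (drop j x)"
proof -
  let ?f = "\<lambda>k. cycle (drop k x)"
  have "\<exists>m \<in> ?f ` {..<length x}. \<forall>b \<in> ?f ` {..<length x}. b \<sqsubseteq> m \<longrightarrow> m = b"
    using assms by (intro so.finite_has_minimal) auto
  then obtain i where "i < length x" "\<forall>j<length x. ?f j \<sqsubseteq> ?f i \<longrightarrow> ?f i = ?f j"
    by auto
  then have i: "i < length x" "\<And>j. j < length x \<Longrightarrow> ?f i \<sqsubseteq> ?f j"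
    using so.le_cases so.order_refl by metis+
  \<comment> \<open>The minimum may be attained several times; the largest such position makes the
    comparison with later suffixes strict.\<close>
  let ?S = "{k. k < length x \<and> ?f k = ?f i}"
  define k where "k = Max ?S"
  have fin: "finite ?S"
    by simp
  have "k \<in> ?S"
    unfolding k_def using i(1) by (intro Max_in[OF fin]) blast
  then have k: "k < length x" "?f k = ?f i"
    by auto
  have min: "?f k \<sqsubseteq> ?f j" if "j < length x" for j
    using i(2)[OF that] k(2) by simp
  have "?f k \<sqsubset> ?f j" if "k < j" "j < length x" for j
  proof -
    have "j \<notin> ?S"
      using Max_ge[OF fin, of j] that(1) unfolding k_def by linarith
    then have "?f j \<noteq> ?f k"
      using that(2) k(2) by simp
    then show ?thesis
      using min[OF that(2)] by (simp add: so.less_le)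
  qed
  then show thesis
    using that k(1) min by blast
qed

text \<open>The shortest suffix \<open>v\<close> with minimal omega power is Lyndon. If the last
  factor \<open>t\<close> before it had a smaller omega power, so would the longer suffix
  \<open>t @ v\<close>, against minimality.\<close>

lemma Lyndon_list_exists: "\<exists>us. Lyndon_list us \<and> concat us = x"
proof (induction x rule: length_induct)
  case (1 x)
  show ?case
  proof (cases "x = []")
    case True
    then show ?thesis
      by (auto simp: Lyndon_list_def intro!: exI[of _ "[]"])
  next
    case False
    then obtain k where k: "k < length x"
      and min: "\<And>j. j < length x \<Longrightarrow> cycle (drop k x) \<sqsubseteq> cycle (drop j x)"
      and strict: "\<And>j. k < j \<Longrightarrow> j < length x \<Longrightarrow> cycle (drop k x) \<sqsubset> cycle (drop j x)"
      using shortest_minimal_suffix by blast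
    let ?v = "drop k x"
    have "generalized_Lyndon r (Fin ?v)"
      unfolding generalized_Lyndon_Fin_iff
    proof (intro conjI allI impI)
      fix j assume "0 < j" "j < length ?v"
      then show "cycle ?v \<sqsubset> cycle (drop j ?v)"
        using strict[of "j + k"] by simp
    qed (use k in simp)
    moreover obtain us where us: "Lyndon_list us" "concat us = take k x"
      using 1 k by (metis length_take min_less_iff_conj nat_less_le min.absorb4)
    moreover have "cycle ?v \<sqsubseteq> cycle (last us)" if "us \<noteq> []"
    proof (rule ccontr)
      let ?u = "concat (butlast us)" and ?t = "last us"
      have "?u @ ?t = concat us"
        using that by (metis append_butlast_last_id concat_append concat.simps append_Nil2)
      then have x: "x = ?u @ ?t @ ?v"
        using us(2) by (metis append.assoc append_take_drop_id)
      assume "\<not> cycle ?v \<sqsubseteq> cycle ?t"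
      then have "cycle ?t \<sqsubset> cycle ?v"
        by simp
      moreover have "?t \<noteq> []"
        using us(1) last_in_set[OF that] not_generalized_Lyndon_Nil by (metis Lyndon_list_def)
      ultimately have "cycle (?t @ ?v) \<sqsubset> cycle ?v"
        using k by (simp add: cycle_append_less_iff)
      moreover have "drop (length ?u) x = ?t @ ?v" "length ?u < length x"
        using x \<open>?t \<noteq> []\<close> by (metis append_eq_conv_conj, metis append_is_Nil_conv length_append
            length_greater_0_conv less_add_same_cancel1)
      ultimately show False
        using min[of "length ?u"] by simp
    qed
    ultimately have "Lyndon_list (us @ [?v])"
      by (auto simp: Lyndon_list_def successively_append_iff)
    moreover have "concat (us @ [?v]) = x"
      using us(2) by simp
    ultimately show ?thesis
      by blast
  qed
qed

section \<open>Limits along prefixes and compactness\<close>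

lemma sless_open:
  assumes "x \<sqsubset> y"
  obtains q where "\<And>x' y'. stake q x' = stake q x \<Longrightarrow> stake q y' = stake q y \<Longrightarrow> x' \<sqsubset> y'"
proof -
  have "x \<noteq> y"
    using assms so.less_irrefl by blast
  then obtain n where "x !! n \<noteq> y !! n"
    using snth_ext by blast
  then have ne: "stake (Suc n) x \<noteq> stake (Suc n) y"
    by (simp only: stake_Suc_eq_iff) simp
  show thesis
    using that[of "Suc n"] sless_cong_stake[OF _ _ ne] assms by metis
qed

lemma stake_cycle_stake: "0 < n \<Longrightarrow> stake n (cycle (stake n x)) = stake n x"
  using stake_cycle_eq[of "stake n x"] by simp

text \<open>The compared streams converge to \<open>sdrop m x\<close> and \<open>y\<close>. A strict
  inequality between the limits depends on finitely many letters, so it would already hold at some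
  large \<open>n\<close> in \<open>U\<close>.\<close>

lemma cycle_drop_stake_limit:
  assumes "infinite U" and U: "\<And>n. n \<in> U \<Longrightarrow> m < n \<Longrightarrow> \<not> cycle (drop m (stake n x)) \<sqsubset> f n"
    and f: "\<And>n. n \<in> U \<Longrightarrow> m < n \<Longrightarrow> stake n (f n) = stake n y"
  shows "y \<sqsubseteq> sdrop m x"
proof (rule ccontr)
  assume "\<not> y \<sqsubseteq> sdrop m x"
  then have "sdrop m x \<sqsubset> y"
    by simp
  then obtain q where q: "\<And>x' y'. stake q x' = stake q (sdrop m x) \<Longrightarrow> stake q y' = stake q y \<Longrightarrow> x' \<sqsubset> y'"
    using sless_open by blast
  obtain n where n: "n \<in> U" "m + q < n"
    using \<open>infinite U\<close> unfolding finite_nat_set_iff_bounded_le by (meson not_le)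
  have "stake q (cycle (drop m (stake n x))) = stake q (sdrop m x)"
    unfolding drop_stake using n(2) by (intro stake_eq_mono[OF stake_cycle_stake]) linarith+
  moreover have "stake q (f n) = stake q y"
    using n(2) by (intro stake_eq_mono[OF f[OF n(1)]]) linarith+
  ultimately show False
    using q U[OF n(1)] n(2) by simp
qed

text \<open>
  A compactness argument: either the factorizations of the prefixes of \<open>w\<close> have an infinite
  branch in common, or some list of factors can be continued by infinitely many different words,
  in which case the rest of \<open>w\<close> is a limit of Lyndon words.
\<close>

definition extensible :: "'a stream \<Rightarrow> 'a list list \<Rightarrow> bool" where
  "extensible w us \<longleftrightarrow> infinite {n. \<exists>vs. Lyndon_list (us @ vs) \<and> concat (us @ vs) = stake n w}"

lemma extensible_Nil: "extensible w []"
  using Lyndon_list_exists by (auto simp: extensible_def)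

lemma extensible_D:
  assumes "extensible w us"
  shows "Lyndon_list us" and "w = concat us @- sdrop (length (concat us)) w"
proof -
  obtain n vs where *: "Lyndon_list (us @ vs)" "concat (us @ vs) = stake n w"
    using not_finite_existsD[of "\<lambda>n. \<exists>vs. Lyndon_list (us @ vs) \<and> concat (us @ vs) = stake n w"] assms
    unfolding extensible_def by blast
  then show "Lyndon_list us"
    using Lyndon_list_append_D by blast
  have "concat us @- concat vs @- sdrop n w = w"
    using *(2) stake_sdrop[of n w] by (metis concat_append shift_append)
  then have "sdrop (length (concat us)) w = concat vs @- sdrop n w"
    by (metis diff_self_eq_0 drop_all order_refl sdrop.simps(1) sdrop_shift shift.simps(1))
  then show "w = concat us @- sdrop (length (concat us)) w"
    using \<open>concat us @- concat vs @- sdrop n w = w\<close> by simp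
qed

text \<open>As no factor is empty, the first \<open>n\<close> factors cover at least
  \<open>n\<close> letters.\<close>

lemma flat_eqI:
  assumes "[] \<notin> sset us" and "\<And>n. \<exists>x. w = concat (stake n us) @- x"
  shows "w = flat us"
proof (rule stake_eq_all)
  fix n
  have len: "n \<le> length (concat (stake n us))"
  proof (induction n)
    case (Suc n)
    have "us !! n \<noteq> []"
      using assms(1) snth_sset by metis
    then have "0 < length (us !! n)"
      by simp
    then show ?case
      using Suc unfolding stake_Suc_snth by (simp del: length_greater_0_conv)
  qed simp
  have "flat us = concat (stake n us) @- flat (sdrop n us)"
    using assms(1)
  proof (induction n arbitrary: us)
    case (Suc n)
    then have "shd us \<noteq> []" "[] \<notin> sset (stl us)"
      by (metis shd_sset, metis stl_sset)
    then show ?case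
      using Suc.IH[of "stl us"] flat_unfold[of us] by simp
  qed simp
  moreover obtain x where "w = concat (stake n us) @- x"
    using assms(2) by blast
  ultimately show "stake n w = stake n (flat us)"
    using len by (metis (no_types, lifting) append_Nil2 diff_is_0_eq stake.simps(1) stake_shift)
qed

lemma nonincreasing_Lyndon_factorization_InfI:
  assumes "\<And>u. u \<in> sset us \<Longrightarrow> generalized_Lyndon r (Fin u)"
    and "\<And>i. cycle (us !! Suc i) \<sqsubseteq> cycle (us !! i)" and "w = flat us"
  shows "nonincreasing_Lyndon_factorization r (Inf (smap Fin us)) (Inf w)"
proof -
  have "[] \<notin> sset us"
    using assms(1) not_generalized_Lyndon_Nil by metis
  moreover have "nonincreasing r (Inf (smap Fin us))"
    unfolding nonincreasing.simps snth_smap omega_power.simps gle_Inf_iff using assms(2) by blast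
  ultimately show ?thesis
    using assms(1,3) unfolding nonincreasing_Lyndon_factorization_def by (auto simp: stream.set_map)
qed

lemma infinite_Lyndon_factorization:
  assumes "\<And>us. extensible w us \<Longrightarrow> \<exists>u. extensible w (us @ [u])"
  shows "\<exists>ls. nonincreasing_Lyndon_factorization r ls (Inf w)"
proof -
  \<comment> \<open>Dependent choice of an infinite branch; the clause for \<open>n = 0\<close>
    fixes its root.\<close>
  have "\<exists>f. \<forall>n::nat. (extensible w (f n) \<and> (n = 0 \<longrightarrow> f n = [])) \<and> (\<exists>u. f (Suc n) = f n @ [u])"
    by (rule dependent_nat_choice) (use extensible_Nil assms in blast)+
  then obtain f where f: "\<And>n. extensible w (f n)" "f 0 = []" "\<And>n. \<exists>u. f (Suc n) = f n @ [u]"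
    by metis
  define us where "us = smap (\<lambda>n. last (f (Suc n))) nats"
  have stake_us: "stake n us = f n" for n
  proof (induction n)
    case (Suc n)
    then show ?case
      unfolding stake_Suc_snth using f(3)[of n] by (auto simp: us_def)
  qed (simp add: f(2))
  have list: "Lyndon_list (stake n us)" for n
    using extensible_D(1)[OF f(1)] stake_us by simp
  have "generalized_Lyndon r (Fin (us !! n))" for n
    using list[of "Suc n"] unfolding stake_Suc_snth by (simp add: Lyndon_list_def)
  then have Lyndon: "generalized_Lyndon r (Fin u)" if "u \<in> sset us" for u
    using that by (auto simp: sset_range)
  moreover have "cycle (us !! Suc n) \<sqsubseteq> cycle (us !! n)" for n
    using list[of "Suc (Suc n)"] unfolding stake_Suc_snth
    by (simp add: Lyndon_list_def successively_append_iff)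
  moreover from Lyndon have "[] \<notin> sset us"
    using not_generalized_Lyndon_Nil by metis
  moreover have "w = flat us"
    using \<open>[] \<notin> sset us\<close> extensible_D(2)[OF f(1)] stake_us by (intro flat_eqI) metis+
  ultimately show ?thesis
    using Lyndon nonincreasing_Lyndon_factorization_InfI by blast
qed

text \<open>Pigeonhole: apart from the empty continuation, every continuation begins with a prefix
  of the rest of \<open>w\<close>. Each such next factor serves only finitely many \<open>n\<close>,
  so infinitely many next factors must occur.\<close>

lemma infinite_Lyndon_prefixes:
  assumes us: "extensible w us" and stuck: "\<And>u. \<not> extensible w (us @ [u])"
  shows "infinite {n. Lyndon_list (us @ [stake n (sdrop (length (concat us)) w)])}" (is "infinite ?U")
proof
  assume fin: "finite ?U"
  let ?W = "sdrop (length (concat us)) w"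
  let ?E = "\<lambda>us. {n. \<exists>vs. Lyndon_list (us @ vs) \<and> concat (us @ vs) = stake n w}"
  have "?E us \<subseteq> {length (concat us)} \<union> (\<Union>k\<in>?U. ?E (us @ [stake k ?W]))"
  proof
    fix n assume "n \<in> ?E us"
    then obtain vs where vs: "Lyndon_list (us @ vs)" "concat (us @ vs) = stake n w"
      by blast
    show "n \<in> {length (concat us)} \<union> (\<Union>k\<in>?U. ?E (us @ [stake k ?W]))"
    proof (cases vs)
      case Nil
      then show ?thesis
        using arg_cong[OF vs(2), of length] by simp
    next
      case (Cons v vs')
      have "concat us @- v @- concat vs' @- sdrop n w = concat us @- ?W"
        using vs(2) Cons stake_sdrop[of n w] extensible_D(2)[OF us]
        by (metis append.assoc concat.simps(2) concat_append shift_append)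
      then have "?W = v @- concat vs' @- sdrop n w"
        by (metis shift_left_inj)
      then have v: "v = stake (length v) ?W"
        by (simp add: stake_shift)
      have "Lyndon_list ((us @ [v]) @ vs')" "concat ((us @ [v]) @ vs') = stake n w"
        using vs Cons by auto
      then have "n \<in> ?E (us @ [v])" "length v \<in> ?U"
        using v Lyndon_list_append_D by (blast, metis (mono_tags, lifting) mem_Collect_eq)
      moreover have "n \<in> ?E (us @ [stake (length v) ?W])"
        using calculation(1) v by metis
      ultimately show ?thesis
        by blast
    qed
  qed
  moreover have "finite (?E (us @ [stake k ?W]))" for k
    using stuck[of "stake k ?W"] unfolding extensible_def by blast
  ultimately have "finite (?E us)"
    using fin by (meson finite.emptyI finite.insertI finite_UN_I finite_UnI finite_subset)
  then show False
    using us unfolding extensible_def by blast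
qed

text \<open>As a limit of Lyndon words, the rest \<open>W\<close> is at most each of its suffixes
  and at most the omega power of the last factor in \<open>us\<close>. If all its proper suffixes
  differ from it, it is the final infinite factor; otherwise its shortest period is repeated
  forever.\<close>

lemma stuck_Lyndon_factorization:
  assumes us: "extensible w us" and stuck: "\<And>u. \<not> extensible w (us @ [u])"
  shows "\<exists>ls. nonincreasing_Lyndon_factorization r ls (Inf w)"
proof -
  define W where "W = sdrop (length (concat us)) w"
  have w: "w = concat us @- W"
    using extensible_D(2)[OF us] by (simp add: W_def)
  have list: "Lyndon_list us"
    using extensible_D(1)[OF us] .
  then have us_Lyndon: "generalized_Lyndon r (Fin u)" if "u \<in> set us" for u
    using that by (simp add: Lyndon_list_def)
  have us_noninc: "cycle (us ! Suc i) \<sqsubseteq> cycle (us ! i)" if "Suc i < length us" for i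
    using list that by (simp add: Lyndon_list_def successively_conv_nth)
  let ?U = "{n. Lyndon_list (us @ [stake n W])}"
  have inf: "infinite ?U"
    using infinite_Lyndon_prefixes[OF us stuck] by (simp add: W_def)
  have W_min: "W \<sqsubseteq> sdrop m W" for m
  proof (cases "m = 0")
    case False
    have "\<not> cycle (drop m (stake n W)) \<sqsubset> cycle (stake n W)" if "n \<in> ?U" "m < n" for n
    proof -
      have "generalized_Lyndon r (Fin (stake n W))"
        using that(1) by (simp add: Lyndon_list_def)
      then have "cycle (stake n W) \<sqsubset> cycle (drop m (stake n W))"
        using that(2) False by (simp add: generalized_Lyndon_Fin_iff)
      then show ?thesis
        using so.less_asym by blast
    qed
    then show ?thesis
      using stake_cycle_stake False by (intro cycle_drop_stake_limit[OF inf, where f = "\<lambda>n. cycle (stake n W)"]) auto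
  qed simp
  have W_last: "W \<sqsubseteq> cycle (last us)" if "us \<noteq> []"
  proof (rule ccontr)
    assume "\<not> W \<sqsubseteq> cycle (last us)"
    then have "cycle (last us) \<sqsubset> W"
      by simp
    then obtain q where q: "\<And>x' y'. stake q x' = stake q (cycle (last us)) \<Longrightarrow> stake q y' = stake q W \<Longrightarrow> x' \<sqsubset> y'"
      using sless_open by blast
    obtain n where n: "n \<in> ?U" "q < n"
      using inf unfolding finite_nat_set_iff_bounded_le by (meson not_le)
    have "stake q (cycle (stake n W)) = stake q W"
      using n(2) by (intro stake_eq_mono[OF stake_cycle_stake]) linarith+
    then have "cycle (last us) \<sqsubset> cycle (stake n W)"
      using q by blast
    moreover have "cycle (stake n W) \<sqsubseteq> cycle (last us)"
      using n(1) that by (auto simp: Lyndon_list_def successively_append_iff)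
    ultimately show False
      by simp
  qed
  have W_last_nth: "W \<sqsubseteq> cycle (us ! i)" if "Suc i = length us" for i
    using W_last that by (metis diff_Suc_1 last_conv_nth length_0_conv nat.distinct(1))
  show ?thesis
  proof (cases "\<forall>m>0. W \<noteq> sdrop m W")
    case True
    then have "W \<sqsubset> sdrop m W" if "0 < m" for m
      using W_min[of m] that unfolding so.le_less by blast
    then have "generalized_Lyndon r (Inf W)"
      by (simp add: generalized_Lyndon_Inf_iff)
    moreover have "nonincreasing r (Fin (map Fin us @ [Inf W]))"
      using us_noninc W_last_nth by (auto simp: nth_append gle_Inf_iff less_Suc_eq)
    ultimately show ?thesis
      using us_Lyndon w unfolding nonincreasing_Lyndon_factorization_def
      by (intro exI[of _ "Fin (map Fin us @ [Inf W])"]) auto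
  next
    case False
    then obtain m where m: "0 < m" "W = sdrop m W" and least: "\<And>k. 0 < k \<Longrightarrow> k < m \<Longrightarrow> W \<noteq> sdrop k W"
      using exists_least_iff[of "\<lambda>m. 0 < m \<and> W = sdrop m W"] by blast
    let ?u = "stake m W"
    have cycle_u: "cycle ?u = W"
      using m stake_sdrop[of m W] by (intro cycle_unique) auto
    have u_Lyndon: "generalized_Lyndon r (Fin ?u)"
      unfolding generalized_Lyndon_Fin_iff cycle_u
    proof (intro conjI allI impI)
      fix k assume k: "0 < k" "k < length ?u"
      \<comment> \<open>Periodicity writes the suffix as a prefixed copy of \<open>W\<close>, so
        that its comparison with \<open>W\<close> becomes one of \<open>cycle (drop k ?u)\<close>
        with \<open>W\<close>.\<close>
      then have "drop k ?u @- W = sdrop k W"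
        using stake_sdrop[of "m - k" "sdrop k W"] m(2) by (simp add: drop_stake)
      moreover have "W \<sqsubset> sdrop k W"
        using W_min[of k] least[of k] k by (auto simp: so.le_less)
      ultimately show "W \<sqsubset> cycle (drop k ?u)"
        using shift_less_iff_cycle_less(2)[of "drop k ?u" W] k by simp
    qed (use m in simp)
    let ?us = "us @- sconst ?u"
    have "?u \<noteq> []"
      using m by simp
    then have "flat (sconst ?u) = cycle ?u"
      using flat_unfold[of "sconst ?u"] cycle_unique by (metis siterate.simps id_apply)
    moreover have "flat (vs @- sconst ?u) = concat vs @- flat (sconst ?u)" if "[] \<notin> set vs" for vs
      using that by (induction vs) auto
    moreover have "[] \<notin> set us"
      using us_Lyndon not_generalized_Lyndon_Nil by metis
    ultimately have "w = flat ?us"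
      using w cycle_u by simp
    moreover have "cycle (?us !! Suc i) \<sqsubseteq> cycle (?us !! i)" for i
    proof -
      have u: "sconst ?u !! j = ?u" for j
        using snth_sset[of "sconst ?u" j] by simp
      consider "Suc i < length us" | "Suc i = length us" | "length us \<le> i"
        by linarith
      then show ?thesis
      proof cases
        case 1
        then show ?thesis
          using us_noninc by (simp add: shift_snth del: snth.simps)
      next
        case 2
        then show ?thesis
          using W_last_nth cycle_u u by (simp add: shift_snth del: snth.simps)
      next
        case 3
        then show ?thesis
          using u by (simp add: shift_snth del: snth.simps)
      qed
    qed
    moreover have "generalized_Lyndon r (Fin v)" if "v \<in> sset ?us" for v
      using us_Lyndon u_Lyndon that by (metis Un_iff singletonD sset_sconst sset_shift)
    ultimately show ?thesis
      using nonincreasing_Lyndon_factorization_InfI by blast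
  qed
qed

lemma nonincreasing_Lyndon_factorization_exists:
  "\<exists>ls. nonincreasing_Lyndon_factorization r ls (Inf w)"
  using infinite_Lyndon_factorization stuck_Lyndon_factorization by blast

end

theorem theorem7:
  fixes r :: "nat \<Rightarrow> 'a rel" and w :: "'a stream"
  assumes "\<And>n. n \<ge> 1 \<Longrightarrow> strict_linear_order (r n)"
  shows "\<exists>!ls. nonincreasing_Lyndon_factorization r ls (Inf w)"
proof -
  interpret letter_orders r
    using assms by unfold_locales
  show ?thesis
    using nonincreasing_Lyndon_factorization_exists nonincreasing_Lyndon_factorization_unique by blast
qed

end
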